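(* Let $d_A,d_B$ be positive integers. Let $\{\mathbf{G}^{(A)}_i\}_{i=0}^{d_A^2-1}$ be a basis of the space of complex $d_A\times d_A$ matrices with $\mathbf{G}^{(A)}_0=\mathbf{I}_{d_A}$, $\mathrm{Tr}(\mathbf{G}^{(A)}_i)=0$ and $\mathrm{Tr}\big((\mathbf{G}^{(A)}_i)^\dagger \mathbf{G}^{(A)}_{i'}\big)=\kappa_A\delta_{ii'}$ for all $i,i'\in\{1,\dots,d_A^2-1\}$, where $\kappa_A\ge 1$; similarly let $\{\mathbf{G}^{(B)}_j\}_{j=0}^{d_B^2-1}$ be such a basis for $d_B\times d_B$ matrices with constant $\kappa_B\ge1$. For a state (positive semidefinite trace-one matrix) $\rho$ on $\mathbb{C}^{d_A}\otimes\mathbb{C}^{d_B}$ define the column vectors $\mathcal{T}^{(A)}\in\mathbb{C}^{d_A^2-1}$, $\mathcal{T}^{(B)}\in\mathbb{C}^{d_B^2-1}$ and the matrix $\mathcal{T}^{(AB)}\in\mathbb{C}^{(d_A^2-1)\times(d_B^2-1)}$ by $t^{(A)}_i=\frac{d_A}{\kappa_A}\mathrm{Tr}\big(\rho(\mathbf{G}^{(A)}_i\otimes \mathbf{I}_{d_B})\big)$, $t^{(B)}_j=\frac{d_B}{\kappa_B}\mathrm{Tr}\big(\rho(\mathbf{I}_{d_A}\otimes \mathbf{G}^{(B)}_j)\big)$, $t^{(AB)}_{ij}=\frac{d_Ad_B}{\kappa_A\kappa_B}\mathrm{Tr}\big(\rho(\mathbf{G}^{(A)}_i\otimes \mathbf{G}^{(B)}_j)\big)$.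 For positive integers $p_1,p_2,q_1,q_2$ and real vectors $\bm u\in\mathbb{R}^{p_1}$, $\bm v\in\mathbb{R}^{p_2}$, $\bm\alpha\in\mathbb{R}^{q_1}$, $\bm\beta\in\mathbb{R}^{q_2}$, define the $(p_1+q_1(d_A^2-1))\times(p_2+q_2(d_B^2-1))$ block matrix $$\mathcal{M}_{\bm u,\bm v,\bm\alpha,\bm\beta}^{(A|B)}(\rho)=\begin{pmatrix}\bm u\bm v^{\rm T} & \bm u\,(\bm\beta\otimes\mathcal{T}^{(B)})^{\rm T}\\ (\bm\alpha\otimes\mathcal{T}^{(A)})\,\bm v^{\rm T} & (\bm\alpha\bm\beta^{\rm T})\otimes\mathcal{T}^{(AB)}\end{pmatrix},$$ where $\otimes$ is the Kronecker product. If $\rho$ is separable, then $$\big\|\mathcal{M}_{\bm u,\bm v,\bm\alpha,\bm\beta}^{(A|B)}(\rho)\big\|_{\rm tr}\le\sqrt{\Big(\|\bm u\|^2+\|\bm\alpha\|^2\frac{d_A^2-d_A}{\kappa_A}\Big)\Big(\|\bm v\|^2+\|\bm\beta\|^2\frac{d_B^2-d_B}{\kappa_B}\Big)}.$$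
   Context: $\|\mathbf{X}\|_{\rm tr}=\mathrm{Tr}\big((\mathbf{X}^\dagger\mathbf{X})^{1/2}\big)$ is the trace norm and $\|\cdot\|$ is the Euclidean norm of a real vector. A state $\rho$ on $\mathbb{C}^{d_A}\otimes\mathbb{C}^{d_B}$ is separable if $\rho=\sum_i p_i\,\rho^{(A)}_i\otimes\rho^{(B)}_i$ with $p_i\ge0$, $\sum_ip_i=1$ and $\rho^{(A)}_i,\rho^{(B)}_i$ pure states on $\mathbb{C}^{d_A}$ and $\mathbb{C}^{d_B}$, respectively. *)

theory Defs
  imports "Jordan_Normal_Form.Matrix"
begin

definition mtrace :: "complex mat \<Rightarrow> complex" where
  "mtrace A = (\<Sum>i<dim_row A. A $$ (i, i))"

definition cadj :: "complex mat \<Rightarrow> complex mat" where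
  "cadj A = mat (dim_col A) (dim_row A) (\<lambda>(i, j). cnj (A $$ (j, i)))"

definition psd :: "nat \<Rightarrow> complex mat \<Rightarrow> bool" where
  "psd n A \<longleftrightarrow> A \<in> carrier_mat n n \<and> cadj A = A \<and>
     (\<forall>v. dim_vec v = n \<longrightarrow>
        Im (map_vec cnj v \<bullet> (A *\<^sub>v v)) = 0 \<and> 0 \<le> Re (map_vec cnj v \<bullet> (A *\<^sub>v v)))"

definition is_state :: "nat \<Rightarrow> complex mat \<Rightarrow> bool" where
  "is_state n \<rho> \<longleftrightarrow> psd n \<rho> \<and> mtrace \<rho> = 1"

definition pure_state :: "nat \<Rightarrow> complex mat \<Rightarrow> bool" where
  "pure_state n \<rho> \<longleftrightarrow> (\<exists>\<psi>. dim_vec \<psi> = n \<and> (\<Sum>i<n. (cmod (\<psi> $ i))\<^sup>2) = 1 \<and>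
      \<rho> = mat n n (\<lambda>(i, j). \<psi> $ i * cnj (\<psi> $ j)))"

definition kron :: "complex mat \<Rightarrow> complex mat \<Rightarrow> complex mat" where
  "kron A B = mat (dim_row A * dim_row B) (dim_col A * dim_col B)
     (\<lambda>(i, j). A $$ (i div dim_row B, j div dim_col B) * B $$ (i mod dim_row B, j mod dim_col B))"

definition separable :: "nat \<Rightarrow> nat \<Rightarrow> complex mat \<Rightarrow> bool" where
  "separable dA dB \<rho> \<longleftrightarrow>
     (\<exists>(k::nat) (p::nat \<Rightarrow> real) \<rho>A \<rho>B.
        (\<forall>i<k. 0 \<le> p i \<and> pure_state dA (\<rho>A i) \<and> pure_state dB (\<rho>B i)) \<and>
        (\<Sum>i<k. p i) = 1 \<and>
        \<rho> = mat (dA * dB) (dA * dB)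
               (\<lambda>(r, c). \<Sum>i<k. complex_of_real (p i) * kron (\<rho>A i) (\<rho>B i) $$ (r, c)))"

definition msqrt :: "complex mat \<Rightarrow> complex mat" where
  "msqrt A = (THE S. psd (dim_row A) S \<and> S * S = A)"

definition trace_norm :: "complex mat \<Rightarrow> real" where
  "trace_norm X = Re (mtrace (msqrt (cadj X * X)))"

definition mlincomb :: "nat \<Rightarrow> nat \<Rightarrow> (nat \<Rightarrow> complex) \<Rightarrow> (nat \<Rightarrow> complex mat) \<Rightarrow> complex mat" where
  "mlincomb d m c G = mat d d (\<lambda>(r, s). \<Sum>i<m. c i * G i $$ (r, s))"

definition op_basis :: "nat \<Rightarrow> real \<Rightarrow> (nat \<Rightarrow> complex mat) \<Rightarrow> bool" where
  "op_basis d \<kappa> G \<longleftrightarrow>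
     (\<forall>i<d\<^sup>2. G i \<in> carrier_mat d d) \<and>
     (\<forall>M \<in> carrier_mat d d. \<exists>c. M = mlincomb d (d\<^sup>2) c G) \<and>
     (\<forall>c. mlincomb d (d\<^sup>2) c G = 0\<^sub>m d d \<longrightarrow> (\<forall>i<d\<^sup>2. c i = 0)) \<and>
     G 0 = 1\<^sub>m d \<and>
     (\<forall>i\<in>{1..<d\<^sup>2}. mtrace (G i) = 0) \<and>
     (\<forall>i\<in>{1..<d\<^sup>2}. \<forall>i'\<in>{1..<d\<^sup>2}.
        mtrace (cadj (G i) * G i') = (if i = i' then complex_of_real \<kappa> else 0))"

text \<open>Correlation vectors/matrix; vector index k corresponds to basis index k+1.\<close>
definition TA :: "nat \<Rightarrow> nat \<Rightarrow> real \<Rightarrow> (nat \<Rightarrow> complex mat) \<Rightarrow> complex mat \<Rightarrow> complex vec" where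
  "TA dA dB \<kappa>A GA \<rho> = vec (dA\<^sup>2 - 1)
     (\<lambda>k. complex_of_real (real dA / \<kappa>A) * mtrace (\<rho> * kron (GA (k + 1)) (1\<^sub>m dB)))"

definition TB :: "nat \<Rightarrow> nat \<Rightarrow> real \<Rightarrow> (nat \<Rightarrow> complex mat) \<Rightarrow> complex mat \<Rightarrow> complex vec" where
  "TB dA dB \<kappa>B GB \<rho> = vec (dB\<^sup>2 - 1)
     (\<lambda>k. complex_of_real (real dB / \<kappa>B) * mtrace (\<rho> * kron (1\<^sub>m dA) (GB (k + 1))))"

definition TAB :: "nat \<Rightarrow> nat \<Rightarrow> real \<Rightarrow> real \<Rightarrow> (nat \<Rightarrow> complex mat) \<Rightarrow> (nat \<Rightarrow> complex mat)
     \<Rightarrow> complex mat \<Rightarrow> complex mat" where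
  "TAB dA dB \<kappa>A \<kappa>B GA GB \<rho> = mat (dA\<^sup>2 - 1) (dB\<^sup>2 - 1)
     (\<lambda>(i, j). complex_of_real (real (dA * dB) / (\<kappa>A * \<kappa>B)) *
               mtrace (\<rho> * kron (GA (i + 1)) (GB (j + 1))))"

definition colm :: "complex vec \<Rightarrow> complex mat" where
  "colm v = mat (dim_vec v) 1 (\<lambda>(i, j). v $ i)"

definition cv :: "real vec \<Rightarrow> complex vec" where
  "cv v = map_vec complex_of_real v"

definition Mmat :: "nat \<Rightarrow> nat \<Rightarrow> real \<Rightarrow> real \<Rightarrow> (nat \<Rightarrow> complex mat) \<Rightarrow> (nat \<Rightarrow> complex mat)
     \<Rightarrow> real vec \<Rightarrow> real vec \<Rightarrow> real vec \<Rightarrow> real vec \<Rightarrow> complex mat \<Rightarrow> complex mat" where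
  "Mmat dA dB \<kappa>A \<kappa>B GA GB u v \<alpha> \<beta> \<rho> =
     four_block_mat
       (colm (cv u) * transpose_mat (colm (cv v)))
       (colm (cv u) * transpose_mat (kron (colm (cv \<beta>)) (colm (TB dA dB \<kappa>B GB \<rho>))))
       (kron (colm (cv \<alpha>)) (colm (TA dA dB \<kappa>A GA \<rho>)) * transpose_mat (colm (cv v)))
       (kron (colm (cv \<alpha>) * transpose_mat (colm (cv \<beta>))) (TAB dA dB \<kappa>A \<kappa>B GA GB \<rho>))"

definition vnorm2 :: "real vec \<Rightarrow> real" where
  "vnorm2 v = (\<Sum>i<dim_vec v. (v $ i)\<^sup>2)"

end

theory Submission
  imports Defs "Jordan_Normal_Form.Spectral_Radius" "HOL-Analysis.L2_Norm"
begin

text \<open>For a product of pure states the block matrix has rank one: it equals \<open>a b\<^sup>T\<close> with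
  \<open>a = (u; \<alpha> \<otimes> T\<^sub>A)\<close> and \<open>b = (v; \<beta> \<otimes> T\<^sub>B)\<close>. Bessel's inequality for the operator basis,
  applied to the pure state (whose Hilbert-Schmidt norm is 1), gives
  \<open>\<parallel>T\<^sub>A\<parallel>\<^sup>2 \<le> (d\<^sub>A\<^sup>2 - d\<^sub>A) / \<kappa>\<^sub>A\<close>. A separable state thus yields a convex combination of rank-one
  matrices \<open>a\<^sub>k b\<^sub>k\<^sup>T\<close>, and the trace norm of such a combination is at most the combination of the
  \<open>\<parallel>a\<^sub>k\<parallel> \<parallel>b\<^sub>k\<parallel>\<close>: if \<open>e\<^sub>i\<close> is an orthonormal eigenbasis of \<open>X\<^sup>\<dagger> X\<close> with eigenvalues \<open>d\<^sub>i\<close>, then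
  the trace norm of \<open>X\<close> is the sum of the numbers \<open>\<langle>X e\<^sub>i, X e\<^sub>i\<rangle> / sqrt d\<^sub>i\<close>, to which
  Cauchy-Schwarz and Bessel apply.\<close>

section \<open>Spectral theorem for Hermitian matrices\<close>

lemma dim_cadj [simp]: "dim_row (cadj A) = dim_col A" "dim_col (cadj A) = dim_row A"
  by (simp_all add: cadj_def)

lemma index_cadj [simp]: "i < dim_col A \<Longrightarrow> j < dim_row A \<Longrightarrow> cadj A $$ (i, j) = cnj (A $$ (j, i))"
  by (simp add: cadj_def)

lemma cadj_carrier: "A \<in> carrier_mat m n \<Longrightarrow> cadj A \<in> carrier_mat n m"
  by auto

lemma cadj_cadj [simp]: "cadj (cadj A) = A"
  by (rule eq_matI) auto

lemma cadj_one [simp]: "cadj (1\<^sub>m n) = 1\<^sub>m n"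
  by (rule eq_matI) auto

lemma index_mult_mat_sum:
  assumes "A \<in> carrier_mat l m" "B \<in> carrier_mat m n" "i < l" "j < n"
  shows "(A * B) $$ (i, j) = (\<Sum>k<m. A $$ (i, k) * B $$ (k, j))"
  using assms by (auto simp: scalar_prod_def atLeast0LessThan intro!: sum.cong)

lemma cadj_mult:
  assumes "A \<in> carrier_mat l m" "B \<in> carrier_mat m n"
  shows "cadj (A * B) = cadj B * cadj A"
proof (rule eq_matI)
  fix i j assume "i < dim_row (cadj B * cadj A)" "j < dim_col (cadj B * cadj A)"
  with assms have ij: "i < n" "j < l" by auto
  have "cadj (A * B) $$ (i, j) = cnj ((A * B) $$ (j, i))" using ij assms by auto
  also have "\<dots> = (\<Sum>k<m. cnj (A $$ (j, k) * B $$ (k, i)))"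
    using ij assms by (simp only: index_mult_mat_sum[OF assms] cnj_sum)
  also have "\<dots> = (cadj B * cadj A) $$ (i, j)"
    using ij assms by (subst index_mult_mat_sum[of _ n m _ l]) (auto intro!: sum.cong)
  finally show "cadj (A * B) $$ (i, j) = (cadj B * cadj A) $$ (i, j)" .
qed (use assms in auto)

text \<open>The entries are real from the outset, so a decomposition through \<open>rdiag\<close>
  already records that the eigenvalues of a Hermitian matrix are real.\<close>

definition rdiag :: "nat \<Rightarrow> (nat \<Rightarrow> real) \<Rightarrow> complex mat" where
  "rdiag n d = mat n n (\<lambda>(i, j). if i = j then complex_of_real (d i) else 0)"

lemma rdiag_carrier [simp]: "rdiag n d \<in> carrier_mat n n"
  by (simp add: rdiag_def)

lemma dim_rdiag [simp]: "dim_row (rdiag n d) = n" "dim_col (rdiag n d) = n"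
  by (simp_all add: rdiag_def)

lemma index_rdiag [simp]:
  "i < n \<Longrightarrow> j < n \<Longrightarrow> rdiag n d $$ (i, j) = (if i = j then complex_of_real (d i) else 0)"
  by (simp add: rdiag_def)

lemma cadj_rdiag [simp]: "cadj (rdiag n d) = rdiag n d"
  by (rule eq_matI) auto

lemma rdiag_mult: "rdiag n d * rdiag n e = rdiag n (\<lambda>i. d i * e i)"
proof (rule eq_matI)
  fix i j assume "i < dim_row (rdiag n (\<lambda>i. d i * e i))" "j < dim_col (rdiag n (\<lambda>i. d i * e i))"
  then have ij: "i < n" "j < n" by auto
  have "(rdiag n d * rdiag n e) $$ (i, j) = (\<Sum>k<n. rdiag n d $$ (i, k) * rdiag n e $$ (k, j))"
    by (rule index_mult_mat_sum) (use ij in auto)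
  also have "\<dots> = (\<Sum>k<n. if k = i then rdiag n d $$ (i, i) * rdiag n e $$ (i, j) else 0)"
    by (rule sum.cong) (use ij in auto)
  finally show "(rdiag n d * rdiag n e) $$ (i, j) = rdiag n (\<lambda>i. d i * e i) $$ (i, j)"
    using ij by simp
qed auto

text \<open>Complete \<open>v\<close> to a basis, orthogonalise it by Gram-Schmidt and normalise the
  columns. The first column keeps the direction of \<open>v\<close>; the scalar \<open>c\<close>
  absorbs the normalisation. This is the change of basis that splits off one eigenvector in the
  spectral theorem.\<close>

lemma unitary_with_first_column:
  fixes v :: "complex vec"
  assumes v: "v \<in> carrier_vec n" and v0: "v \<noteq> 0\<^sub>v n"
  obtains W c where "W \<in> carrier_mat n n" "cadj W * W = 1\<^sub>m n" "col W 0 = c \<cdot>\<^sub>v v"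
proof -
  interpret cof_vec_space n "TYPE(complex)" .
  define b where "b = basis_completion v"
  define ws where "ws = gram_schmidt n b"
  from v v0 have n: "0 < n" by (cases n) auto
  note bc = basis_completion[OF v v0, folded b_def]
  have hdb: "hd b = v" by (simp add: b_def basis_completion_def Let_def)
  with bc(6) n obtain vs where bv: "b = v # vs" by (cases b) auto
  note gs = gram_schmidt_result[OF bc(2) bc(4) bc(5) refl, folded ws_def]
  have len: "length ws = n" using gs(4) bc(6) by simp
  \<comment> \<open>Gram-Schmidt leaves the first vector of the list untouched.\<close>
  have ws0: "ws ! 0 = v"
    using gram_schmidt_hd[OF v, of vs, folded bv] len n hd_conv_nth[of ws]
    unfolding ws_def[symmetric] by auto
  have wsc: "ws ! j \<in> carrier_vec n" if "j < n" for j
    using gs(3) len that by auto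
  define N where "N j = (\<Sum>k<n. (cmod (ws ! j $ k))\<^sup>2)" for j
  have prod: "ws ! i \<bullet>c ws ! j = (\<Sum>k<n. ws ! i $ k * cnj (ws ! j $ k))" if "i < n" "j < n" for i j
    using wsc[OF that(1)] wsc[OF that(2)] by (auto simp: scalar_prod_def atLeast0LessThan)
  have NN: "ws ! j \<bullet>c ws ! j = complex_of_real (N j)" if "j < n" for j
    by (simp only: prod[OF that that] N_def of_real_sum complex_norm_square)
  \<comment> \<open>\<open>corthogonal\<close> is an equivalence: besides orthogonality it says that
    no \<open>ws ! j\<close> has norm zero, which makes the division by \<open>sqrt (N j)\<close>
    legitimate.\<close>
  have orth: "(ws ! i \<bullet>c ws ! j = 0) \<longleftrightarrow> i \<noteq> j" if "i < n" "j < n" for i j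
    using gs(2) len that unfolding corthogonal_def by auto
  have Npos: "0 < N j" if "j < n" for j
  proof -
    have "N j \<noteq> 0" using orth[OF that that] NN[OF that] by auto
    moreover have "0 \<le> N j" unfolding N_def by (intro sum_nonneg) auto
    ultimately show ?thesis by simp
  qed
  define W where "W = mat n n (\<lambda>(i, j). ws ! j $ i / complex_of_real (sqrt (N j)))"
  have W: "W \<in> carrier_mat n n" by (simp add: W_def)
  have "cadj W * W = 1\<^sub>m n"
  proof (rule eq_matI)
    fix i j assume "i < dim_row (1\<^sub>m n)" "j < dim_col (1\<^sub>m n)"
    then have ij: "i < n" "j < n" by auto
    have "(cadj W * W) $$ (i, j) = (\<Sum>k<n. cadj W $$ (i, k) * W $$ (k, j))"
      using ij W by (intro index_mult_mat_sum) auto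
    also have "\<dots> = (\<Sum>k<n. ws ! j $ k * cnj (ws ! i $ k)
        / (complex_of_real (sqrt (N i)) * complex_of_real (sqrt (N j))))"
      using ij W by (intro sum.cong) (auto simp: W_def)
    also have "\<dots> = (ws ! j \<bullet>c ws ! i) / (complex_of_real (sqrt (N i)) * complex_of_real (sqrt (N j)))"
      by (simp add: prod[OF ij(2,1)] sum_divide_distrib)
    also have "\<dots> = (if i = j then 1 else 0)"
    proof (cases "i = j")
      case True
      have "complex_of_real (sqrt (N j)) * complex_of_real (sqrt (N j)) = complex_of_real (N j)"
        using Npos[OF ij(2)] by (simp flip: of_real_mult)
      then show ?thesis using True NN[OF ij(2)] Npos[OF ij(2)] by simp
    next
      case False
      then show ?thesis using orth[OF ij(2,1)] by auto
    qed
    finally show "(cadj W * W) $$ (i, j) = 1\<^sub>m n $$ (i, j)" using ij by simp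
  qed (use W in auto)
  moreover have "col W 0 = (1 / complex_of_real (sqrt (N 0))) \<cdot>\<^sub>v v"
    using n v by (intro eq_vecI) (auto simp: W_def ws0)
  ultimately show ?thesis using that W by blast
qed

lemma unitary_inverse:
  assumes "U \<in> carrier_mat n n" "cadj U * U = 1\<^sub>m n"
  shows "U * cadj U = 1\<^sub>m n"
  by (rule mat_mult_left_right_inverse[of _ n]) (use assms in auto)

text \<open>Deflation: in an orthonormal basis starting with an eigenvector, the first column of the
  matrix vanishes below the corner. By Hermitian symmetry so does the first row to the right of it,
  and the remaining block is Hermitian of size \<open>n\<close>.\<close>

theorem hermitian_spectral_decomposition:
  assumes "A \<in> carrier_mat n n" "cadj A = A"
  shows "\<exists>U d. U \<in> carrier_mat n n \<and> cadj U * U = 1\<^sub>m n \<and> A = U * rdiag n d * cadj U"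
  using assms
proof (induction n arbitrary: A)
  case 0
  then show ?case by (intro exI[of _ "1\<^sub>m 0"] exI[of _ "\<lambda>_. 0"]) (auto intro!: eq_matI)
next
  case (Suc n)
  note A = Suc.prems
  from spectrum_non_empty[OF A(1)] obtain e where "eigenvalue A e"
    by (auto simp: spectrum_def)
  then obtain v where ev: "eigenvector A v e" by (auto simp: eigenvalue_def)
  then have v: "v \<in> carrier_vec (Suc n)" "v \<noteq> 0\<^sub>v (Suc n)" and Av: "A *\<^sub>v v = e \<cdot>\<^sub>v v"
    using A by (auto simp: eigenvector_def)
  from unitary_with_first_column[OF v] obtain W c where
    W: "W \<in> carrier_mat (Suc n) (Suc n)" and WW: "cadj W * W = 1\<^sub>m (Suc n)"
    and W0: "col W 0 = c \<cdot>\<^sub>v v" by blast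
  note WW' = unitary_inverse[OF W WW]
  have cW: "cadj W \<in> carrier_mat (Suc n) (Suc n)" using W by auto
  define B where "B = cadj W * (A * W)"
  have B: "B \<in> carrier_mat (Suc n) (Suc n)" using W A unfolding B_def by auto
  have Bh: "cadj B = B"
    unfolding B_def using A W cW
    by (simp add: cadj_mult[of _ "Suc n" "Suc n" _ "Suc n"] assoc_mult_mat[of _ "Suc n" "Suc n" _ "Suc n" _ "Suc n"])
  have AW0: "col (A * W) 0 = e \<cdot>\<^sub>v col W 0"
  proof -
    have "col (A * W) 0 = A *\<^sub>v col W 0" using A W by (intro col_mult2) auto
    also have "\<dots> = c \<cdot>\<^sub>v (A *\<^sub>v v)" unfolding W0 using A v by (intro mult_mat_vec) auto
    also have "\<dots> = e \<cdot>\<^sub>v col W 0" unfolding W0 Av by (simp add: smult_smult_assoc mult.commute)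
    finally show ?thesis .
  qed
  \<comment> \<open>The first column of \<open>B\<close> is \<open>e\<close> times the first column
    of \<open>cadj W * W\<close>, which is the identity.\<close>
  have B0: "B $$ (i, 0) = (if i = 0 then e else 0)" if i: "i < Suc n" for i
  proof -
    have "B $$ (i, 0) = row (cadj W) i \<bullet> col (A * W) 0" unfolding B_def using W A i by auto
    also have "\<dots> = e * (row (cadj W) i \<bullet> col W 0)" unfolding AW0 using W i by simp
    also have "row (cadj W) i \<bullet> col W 0 = (cadj W * W) $$ (i, 0)" using W i by simp
    finally show ?thesis using i by (simp add: WW)
  qed
  have B0': "B $$ (0, i) = (if i = 0 then cnj e else 0)" if i: "i < Suc n" for i
  proof -
    have "cadj B $$ (0, i) = cnj (B $$ (i, 0))" using B i by simp
    then show ?thesis using B0[OF i] by (simp add: Bh)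
  qed
  \<comment> \<open>The corner entry of the Hermitian matrix \<open>B\<close> equals both
    \<open>e\<close> and \<open>cnj e\<close>.\<close>
  have e: "e = complex_of_real (Re e)" using B0[of 0] B0'[of 0] by (simp add: complex_eq_iff)
  define C where "C = mat n n (\<lambda>(i, j). B $$ (Suc i, Suc j))"
  have C: "C \<in> carrier_mat n n" by (simp add: C_def)
  have Ch: "cadj C = C"
  proof (rule eq_matI)
    fix i j assume "i < dim_row C" "j < dim_col C"
    then have ij: "i < n" "j < n" using C by auto
    have "cadj B $$ (Suc i, Suc j) = cnj (B $$ (Suc j, Suc i))" using ij B by simp
    then show "cadj C $$ (i, j) = C $$ (i, j)" using ij by (simp add: Bh) (simp add: C_def)
  qed (use C in auto)
  from Suc.IH[OF C Ch] obtain U3 d3 where U3: "U3 \<in> carrier_mat n n"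
    and UU3: "cadj U3 * U3 = 1\<^sub>m n" and C3: "C = U3 * rdiag n d3 * cadj U3" by blast
  define d where "d i = (case i of 0 \<Rightarrow> Re e | Suc k \<Rightarrow> d3 k)" for i
  \<comment> \<open>The diagonalisation of the small block is extended by the identity on the first
    coordinate; the unitary sought is \<open>W * V\<close>.\<close>
  define V where "V = four_block_mat (1\<^sub>m 1) (0\<^sub>m 1 n) (0\<^sub>m n 1) U3"
  have V: "V \<in> carrier_mat (Suc n) (Suc n)" unfolding V_def using U3 by (auto intro!: carrier_matI)
  have cV: "cadj V = four_block_mat (1\<^sub>m 1) (0\<^sub>m 1 n) (0\<^sub>m n 1) (cadj U3)"
    unfolding V_def
    by (rule eq_matI) (use U3 in auto)
  have cVc: "cadj V \<in> carrier_mat (Suc n) (Suc n)" using V by auto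
  have VV: "cadj V * V = 1\<^sub>m (Suc n)"
    unfolding cV unfolding V_def using U3 UU3
    by (subst mult_four_block_mat[of _ 1 1 _ n _ n _ _ 1 _ n]) (auto simp: four_block_one_mat[of 1 n, simplified])
  have D: "rdiag (Suc n) d = four_block_mat (rdiag 1 (\<lambda>_. Re e)) (0\<^sub>m 1 n) (0\<^sub>m n 1) (rdiag n d3)"
    by (rule eq_matI) (auto simp: d_def split: nat.splits)
  have Bblock: "B = four_block_mat (rdiag 1 (\<lambda>_. Re e)) (0\<^sub>m 1 n) (0\<^sub>m n 1) C"
  proof (rule eq_matI)
    fix i j assume "i < dim_row (four_block_mat (rdiag 1 (\<lambda>_. Re e)) (0\<^sub>m 1 n) (0\<^sub>m n 1) C)"
      "j < dim_col (four_block_mat (rdiag 1 (\<lambda>_. Re e)) (0\<^sub>m 1 n) (0\<^sub>m n 1) C)"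
    then have ij: "i < Suc n" "j < Suc n" using C by auto
    show "B $$ (i, j) = four_block_mat (rdiag 1 (\<lambda>_. Re e)) (0\<^sub>m 1 n) (0\<^sub>m n 1) C $$ (i, j)"
      using ij C B0[OF ij(1)] B0'[OF ij(2)] e
      by (cases i; cases j) (auto simp: C_def)
  qed (use B C in auto)
  have VDV: "V * rdiag (Suc n) d * cadj V = B"
  proof -
    have "U3 * rdiag n d3 * cadj U3 \<in> carrier_mat n n" using U3 by auto
    then have "0\<^sub>m n n + U3 * rdiag n d3 * cadj U3 = U3 * rdiag n d3 * cadj U3"
      by (rule left_add_zero_mat)
    then show ?thesis
      unfolding D cV Bblock C3 unfolding V_def using U3 cadj_carrier[OF U3]
      by (simp add: mult_four_block_mat[of _ 1 1 _ n _ n _ _ 1 _ n, simplified])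
  qed
  define U where "U = W * V"
  have U: "U \<in> carrier_mat (Suc n) (Suc n)" using W V by (simp add: U_def)
  note assoc = assoc_mult_mat[of _ "Suc n" "Suc n" _ "Suc n" _ "Suc n"] mult_carrier_mat[of _ "Suc n" "Suc n" _ "Suc n"]
  have cU: "cadj U = cadj V * cadj W" unfolding U_def using W V by (rule cadj_mult)
  have "cadj U * U = cadj V * (cadj W * W) * V"
    unfolding cU unfolding U_def using W V cW cVc by (simp add: assoc)
  then have "cadj U * U = 1\<^sub>m (Suc n)" using V cVc by (simp add: WW VV)
  moreover have "U * rdiag (Suc n) d * cadj U = W * B * cadj W"
    unfolding cU VDV[symmetric] unfolding U_def using W V cW cVc by (simp add: assoc)
  moreover have "W * B * cadj W = A"
  proof -
    have "W * B * cadj W = (W * cadj W) * A * (W * cadj W)"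
      unfolding B_def using W A cW by (simp add: assoc)
    then show ?thesis using A by (simp add: WW')
  qed
  ultimately show ?case using U by metis
qed

section \<open>Square roots and singular values\<close>

text \<open>Connects matrix entries with the quadratic form in the definition of \<open>psd\<close>:
  the diagonal of a conjugated matrix lists the values of the form at the columns of
  \<open>U\<close>.\<close>

lemma cadj_mult_mult_index:
  assumes U: "U \<in> carrier_mat n m" and A: "A \<in> carrier_mat n n" and i: "i < m"
  shows "(cadj U * (A * U)) $$ (i, i) = map_vec cnj (col U i) \<bullet> (A *\<^sub>v col U i)"
proof -
  have "row (cadj U) i = map_vec cnj (col U i)"
    using U i by (intro eq_vecI) auto
  moreover have "col (A * U) i = A *\<^sub>v col U i"
    using A U i by (intro col_mult2) auto
  ultimately show ?thesis using U A i by simp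
qed

lemma psd_conjugate_diag_nonneg:
  assumes "psd n A" "U \<in> carrier_mat n m" "i < m"
  shows "0 \<le> Re ((cadj U * (A * U)) $$ (i, i))"
  using assms cadj_mult_mult_index[of U n m A i] unfolding psd_def by auto

text \<open>The quadratic form at \<open>v\<close> is the squared length of
  \<open>R *\<^sub>v v\<close>.\<close>

lemma psd_cadj_mult:
  assumes R: "R \<in> carrier_mat m n"
  shows "psd n (cadj R * R)"
  unfolding psd_def
proof (intro conjI allI impI)
  have cR: "cadj R \<in> carrier_mat n m" using R by auto
  show "cadj R * R \<in> carrier_mat n n" using R by auto
  show "cadj (cadj R * R) = cadj R * R" using cadj_mult[OF cR R] by simp
  fix v :: "complex vec" assume "dim_vec v = n"
  then have v: "v \<in> carrier_vec n" by auto
  define w where "w = R *\<^sub>v v"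
  have w: "w \<in> carrier_vec m" using R v unfolding w_def by auto
  have wk: "w $ k = (\<Sum>i<n. R $$ (k, i) * v $ i)" if "k < m" for k
    using R v that by (auto simp: w_def scalar_prod_def atLeast0LessThan intro!: sum.cong)
  have "(cadj R * R) *\<^sub>v v = cadj R *\<^sub>v w"
    unfolding w_def using cR R v by (rule assoc_mult_mat_vec)
  then have "map_vec cnj v \<bullet> ((cadj R * R) *\<^sub>v v)
      = (\<Sum>i<n. cnj (v $ i) * (\<Sum>k<m. cnj (R $$ (k, i)) * w $ k))"
    using R v w by (auto simp: scalar_prod_def atLeast0LessThan intro!: sum.cong)
  also have "\<dots> = (\<Sum>k<m. \<Sum>i<n. cnj (v $ i) * (cnj (R $$ (k, i)) * w $ k))"
    by (simp only: sum_distrib_left) (rule sum.swap)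
  also have "\<dots> = (\<Sum>k<m. cnj (w $ k) * w $ k)"
    by (rule sum.cong) (simp_all add: wk sum_distrib_right sum_distrib_left mult_ac)
  also have "\<dots> = complex_of_real (\<Sum>k<m. (cmod (w $ k))\<^sup>2)"
    by (simp only: of_real_sum complex_norm_square mult.commute)
  finally have q: "map_vec cnj v \<bullet> ((cadj R * R) *\<^sub>v v) = complex_of_real (\<Sum>k<m. (cmod (w $ k))\<^sup>2)" .
  show "Im (map_vec cnj v \<bullet> ((cadj R * R) *\<^sub>v v)) = 0" unfolding q by simp
  show "0 \<le> Re (map_vec cnj v \<bullet> ((cadj R * R) *\<^sub>v v))" unfolding q by (simp add: sum_nonneg)
qed

text \<open>In an eigenbasis of \<open>S - T\<close> with eigenvalues \<open>d\<close>, the diagonal of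
  \<open>S\<^sup>2 - T\<^sup>2 = S (S - T) + (S - T) T\<close> reads \<open>d i * (S i i + T i i) = 0\<close>, which forces \<open>d = 0\<close>.\<close>
lemma psd_sqrt_unique:
  assumes pS: "psd n S" and pT: "psd n T" and eq: "S * S = T * T"
  shows "S = T"
proof -
  from pS pT have S: "S \<in> carrier_mat n n" "cadj S = S" and T: "T \<in> carrier_mat n n" "cadj T = T"
    by (auto simp: psd_def)
  have ST: "S - T \<in> carrier_mat n n" using T by auto
  have "cadj (S - T) = S - T"
  proof (rule eq_matI)
    fix i j assume "i < dim_row (S - T)" "j < dim_col (S - T)"
    then have ij: "i < n" "j < n" using T by auto
    have "cadj S $$ (i, j) = cnj (S $$ (j, i))" "cadj T $$ (i, j) = cnj (T $$ (j, i))"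
      using ij S(1) T(1) by simp_all
    then show "cadj (S - T) $$ (i, j) = (S - T) $$ (i, j)"
      using ij S T by simp
  qed (use S T in auto)
  from hermitian_spectral_decomposition[OF ST this] obtain U d where
    U: "U \<in> carrier_mat n n" and UU: "cadj U * U = 1\<^sub>m n" and D: "S - T = U * rdiag n d * cadj U"
    by blast
  have cU: "cadj U \<in> carrier_mat n n" using U by auto
  note UU' = unitary_inverse[OF U UU]
  note assoc = assoc_mult_mat[of _ n n _ n _ n] mult_carrier_mat[of _ n n _ n]
  define S' where "S' = cadj U * (S * U)"
  define T' where "T' = cadj U * (T * U)"
  have S': "S' \<in> carrier_mat n n" and T': "T' \<in> carrier_mat n n"
    using S T U cU by (auto simp: S'_def T'_def)
  \<comment> \<open>Conjugation by \<open>U\<close> respects squares because the inner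
    \<open>U * cadj U\<close> cancels.\<close>
  have sq: "cadj U * (M * U) * (cadj U * (M * U)) = cadj U * (M * M * U)"
    if M: "M \<in> carrier_mat n n" for M
  proof -
    have "cadj U * (M * U) * (cadj U * (M * U)) = cadj U * (M * ((U * cadj U) * (M * U)))"
      using M U cU by (simp add: assoc)
    then show ?thesis using M U by (simp add: UU' assoc)
  qed
  have eq': "S' * S' = T' * T'"
    unfolding S'_def T'_def using S T by (simp add: sq eq)
  have "S' - T' = cadj U * ((S - T) * U)"
    unfolding S'_def T'_def using S T U cU
    by (simp add: minus_mult_distrib_mat[of _ n n _ _ n] mult_minus_distrib_mat[of _ n n _ n]
        mult_carrier_mat[of _ n n _ n])
  also have "\<dots> = (cadj U * U) * rdiag n d * (cadj U * U)"
    unfolding D using U cU by (simp add: assoc)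
  also have "\<dots> = rdiag n d" unfolding UU by simp
  finally have diff: "S' - T' = rdiag n d" .
  have S'ij: "S' $$ (i, j) = T' $$ (i, j) + (if i = j then complex_of_real (d i) else 0)"
    if "i < n" "j < n" for i j
    using arg_cong[OF diff, of "\<lambda>M. M $$ (i, j)"] S' T' that by (simp add: algebra_simps)
  have "d i = 0" if i: "i < n" for i
  proof -
    have "(\<Sum>k<n. S' $$ (i, k) * S' $$ (k, i)) = (\<Sum>k<n. T' $$ (i, k) * T' $$ (k, i))"
      using arg_cong[OF eq', of "\<lambda>M. M $$ (i, i)"] i
      by (simp only: index_mult_mat_sum[OF S' S'] index_mult_mat_sum[OF T' T'])
    \<comment> \<open>Off the diagonal \<open>S'\<close> and \<open>T'\<close> agree, so only the
      term \<open>k = i\<close> differs, by the difference of two squares of diagonal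
      entries.\<close>
    moreover have "(\<Sum>k<n. S' $$ (i, k) * S' $$ (k, i)) = (\<Sum>k<n. T' $$ (i, k) * T' $$ (k, i)
        + (if k = i then complex_of_real (d i) * (S' $$ (i, i) + T' $$ (i, i)) else 0))"
      by (rule sum.cong) (use i in \<open>auto simp: S'ij algebra_simps\<close>)
    ultimately have "complex_of_real (d i) * (S' $$ (i, i) + T' $$ (i, i)) = 0"
      using i by (simp add: sum.distrib)
    \<comment> \<open>In the second case two nonnegative numbers with sum zero both vanish, and
      \<open>d i\<close> is their difference.\<close>
    then have "d i = 0 \<or> Re (S' $$ (i, i)) + Re (T' $$ (i, i)) = 0"
      by (auto simp: complex_eq_iff)
    moreover have "0 \<le> Re (S' $$ (i, i))" "0 \<le> Re (T' $$ (i, i))"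
      unfolding S'_def T'_def
      by (rule psd_conjugate_diag_nonneg[OF pS U i], rule psd_conjugate_diag_nonneg[OF pT U i])
    moreover have "Re (S' $$ (i, i)) = Re (T' $$ (i, i)) + d i" using S'ij[OF i i] by simp
    ultimately show ?thesis by auto
  qed
  then have "rdiag n d = 0\<^sub>m n n" by (intro eq_matI) auto
  then have "S - T = 0\<^sub>m n n" unfolding D using U cU by simp
  then have "(S - T) $$ (i, j) = 0" if "i < n" "j < n" for i j using that by simp
  then show ?thesis using S T by (intro eq_matI) auto
qed

text \<open>\<open>msqrt\<close> is a definite description, so it can be evaluated only through
  uniqueness: any positive semidefinite root that can be exhibited is the value.\<close>

lemma msqrt_eqI:
  assumes "A \<in> carrier_mat n n" "psd n S" "S * S = A"
  shows "msqrt A = S"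
  unfolding msqrt_def
  by (rule the_equality) (use assms psd_sqrt_unique in auto)

lemma mtrace_mult:
  assumes "A \<in> carrier_mat m n" "B \<in> carrier_mat n m"
  shows "mtrace (A * B) = (\<Sum>i<m. \<Sum>j<n. A $$ (i, j) * B $$ (j, i))"
  unfolding mtrace_def using assms
  by (auto simp del: index_mult_mat(1) simp: index_mult_mat_sum[OF assms])

lemma mtrace_mult_commute:
  assumes "A \<in> carrier_mat m n" "B \<in> carrier_mat n m"
  shows "mtrace (A * B) = mtrace (B * A)"
  unfolding mtrace_mult[OF assms] mtrace_mult[OF assms(2,1)]
  by (subst sum.swap) (simp add: mult.commute)

text \<open>The columns of \<open>U\<close> are right singular vectors and the numbers
  \<open>sqrt (d i)\<close> are the singular values. The statement retains that the columns of
  \<open>X * U\<close> are orthogonal with squared lengths \<open>d i\<close>, since Bessel's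
  inequality will be applied to them.\<close>

lemma trace_norm_singular_values:
  assumes X: "X \<in> carrier_mat m n"
  obtains U d where "U \<in> carrier_mat n n" "cadj U * U = 1\<^sub>m n" "\<And>i. i < n \<Longrightarrow> 0 \<le> d i"
    "cadj (X * U) * (X * U) = rdiag n d" "trace_norm X = (\<Sum>i<n. sqrt (d i))"
proof -
  have cX: "cadj X \<in> carrier_mat n m" using X by auto
  have XX: "cadj X * X \<in> carrier_mat n n" using X by auto
  have "cadj (cadj X * X) = cadj X * X" using cadj_mult[OF cX X] by simp
  from hermitian_spectral_decomposition[OF XX this] obtain U d where
    U: "U \<in> carrier_mat n n" and UU: "cadj U * U = 1\<^sub>m n" and D: "cadj X * X = U * rdiag n d * cadj U"
    by blast
  have cU: "cadj U \<in> carrier_mat n n" using U by auto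
  note assoc = assoc_mult_mat[of _ n n _ n _ n] mult_carrier_mat[of _ n n _ n]
  have cXU: "cadj (X * U) = cadj U * cadj X" using X U by (rule cadj_mult)
  have "cadj (X * U) * (X * U) = cadj U * (cadj X * X) * U"
    unfolding cXU using X U cX cU
    by (simp add: assoc_mult_mat[of _ n n _ n _ n] assoc_mult_mat[of _ n n _ m _ n]
        assoc_mult_mat[of _ n m _ n _ n] mult_carrier_mat[of _ n m _ n] mult_carrier_mat[of _ m n _ n])
  also have "\<dots> = (cadj U * U) * rdiag n d * (cadj U * U)"
    unfolding D using U cU by (simp add: assoc)
  finally have diag: "cadj (X * U) * (X * U) = rdiag n d" by (simp add: UU)
  have d0: "0 \<le> d i" if i: "i < n" for i
  proof -
    \<comment> \<open>\<open>d i\<close> is a diagonal entry of a positive semidefinite matrix;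
      conjugation by the identity brings it into the form of
      \<open>psd_conjugate_diag_nonneg\<close>.\<close>
    have "0 \<le> Re ((cadj (1\<^sub>m n) * (cadj (X * U) * (X * U) * 1\<^sub>m n)) $$ (i, i))"
      by (rule psd_conjugate_diag_nonneg[OF psd_cadj_mult[of _ m]]) (use X U i in auto)
    then show ?thesis unfolding diag using i by simp
  qed
  define s where "s i = sqrt (d i)" for i
  \<comment> \<open>The square roots of the singular values, that is, fourth roots of the
    \<open>d i\<close>, give the root \<open>S\<close> the form \<open>cadj R * R\<close>, which
    exhibits it as positive semidefinite.\<close>
  define R where "R = rdiag n (\<lambda>i. sqrt (s i)) * cadj U"
  define S where "S = U * rdiag n s * cadj U"
  have R: "R \<in> carrier_mat n n" using cU by (simp add: R_def assoc)
  have rs: "rdiag n (\<lambda>i. sqrt (s i)) * rdiag n (\<lambda>i. sqrt (s i)) = rdiag n s"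
    unfolding rdiag_mult by (rule eq_matI) (auto simp: s_def d0)
  have cR: "cadj R = U * rdiag n (\<lambda>i. sqrt (s i))"
    unfolding R_def using cU by (simp add: cadj_mult[of _ n n _ n])
  have "cadj R * R = U * (rdiag n (\<lambda>i. sqrt (s i)) * rdiag n (\<lambda>i. sqrt (s i))) * cadj U"
    unfolding cR unfolding R_def using U cU by (simp add: assoc)
  then have "S = cadj R * R" unfolding S_def rs by simp
  then have pS: "psd n S" using psd_cadj_mult[OF R] by simp
  have ss: "rdiag n s * rdiag n s = rdiag n d"
    unfolding rdiag_mult by (rule eq_matI) (auto simp: s_def d0)
  have "S * S = U * rdiag n s * (cadj U * U) * rdiag n s * cadj U"
    unfolding S_def using U cU by (simp add: assoc)
  also have "\<dots> = U * (rdiag n s * rdiag n s) * cadj U"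
    unfolding UU using U cU by (simp add: assoc)
  finally have "S * S = cadj X * X" unfolding D ss .
  with XX pS have "msqrt (cadj X * X) = S" by (intro msqrt_eqI)
  moreover have "mtrace S = mtrace (cadj U * (U * rdiag n s))"
    unfolding S_def using U cU by (intro mtrace_mult_commute) auto
  moreover have "cadj U * (U * rdiag n s) = (cadj U * U) * rdiag n s"
    using U cU by (simp add: assoc)
  ultimately have "trace_norm X = Re (mtrace (rdiag n s))"
    unfolding trace_norm_def by (simp add: UU)
  also have "\<dots> = (\<Sum>i<n. sqrt (d i))" by (simp add: mtrace_def s_def)
  finally show ?thesis using that U UU d0 diag by blast
qed

section \<open>Trace norm of sums of rank-one matrices\<close>

text \<open>Zero vectors \<open>g i\<close> are allowed: their summands vanish because \<open>x / 0 = 0\<close>.\<close>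
lemma bessel_inequality:
  fixes g :: "'i \<Rightarrow> 'a \<Rightarrow> complex" and a :: "'a \<Rightarrow> complex" and N :: "'i \<Rightarrow> real"
  assumes fin: "finite I"
    and orth: "\<And>i j. i \<in> I \<Longrightarrow> j \<in> I \<Longrightarrow>
      (\<Sum>s\<in>S. cnj (g i s) * g j s) = (if i = j then complex_of_real (N i) else 0)"
  shows "(\<Sum>i\<in>I. (cmod (\<Sum>s\<in>S. cnj (g i s) * a s))\<^sup>2 / N i) \<le> (\<Sum>s\<in>S. (cmod (a s))\<^sup>2)"
proof -
  define ip where "ip i = (\<Sum>s\<in>S. cnj (g i s) * a s)" for i
  define c where "c i = ip i / complex_of_real (N i)" for i
  \<comment> \<open>\<open>w\<close> is the orthogonal projection of \<open>a\<close> onto the span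
    of the \<open>g i\<close>. Both the pairing of \<open>w\<close> with \<open>a\<close> and the
    squared length of \<open>w\<close> turn out to be \<open>P\<close>.\<close>
  define w where "w s = (\<Sum>i\<in>I. c i * g i s)" for s
  define P where "P = (\<Sum>i\<in>I. (cmod (ip i))\<^sup>2 / N i)"
  have ci: "cnj (c i) * ip i = complex_of_real ((cmod (ip i))\<^sup>2 / N i)" for i
    by (simp add: c_def complex_norm_square mult.commute del: of_real_power)
  have "(\<Sum>s\<in>S. cnj (w s) * a s) = (\<Sum>i\<in>I. \<Sum>s\<in>S. cnj (c i) * (cnj (g i s) * a s))"
    unfolding w_def cnj_sum sum_distrib_right by (subst sum.swap) (simp add: mult_ac)
  also have "\<dots> = (\<Sum>i\<in>I. cnj (c i) * ip i)"
    by (simp add: ip_def sum_distrib_left)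
  finally have wa: "(\<Sum>s\<in>S. cnj (w s) * a s) = complex_of_real P"
    by (simp add: ci P_def)
  have gw: "(\<Sum>s\<in>S. cnj (g i s) * w s) = c i * complex_of_real (N i)" if i: "i \<in> I" for i
  proof -
    have "(\<Sum>s\<in>S. cnj (g i s) * w s) = (\<Sum>j\<in>I. c j * (\<Sum>s\<in>S. cnj (g i s) * g j s))"
      unfolding w_def sum_distrib_left by (subst sum.swap) (simp add: mult_ac)
    also have "\<dots> = (\<Sum>j\<in>I. if j = i then c i * complex_of_real (N i) else 0)"
      by (rule sum.cong) (use i orth in auto)
    finally show ?thesis using fin i by simp
  qed
  have "(\<Sum>s\<in>S. cnj (w s) * w s) = (\<Sum>i\<in>I. \<Sum>s\<in>S. cnj (c i) * (cnj (g i s) * w s))"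
    by (subst (1) w_def) (simp only: cnj_sum sum_distrib_right, subst sum.swap, simp add: mult_ac)
  also have "\<dots> = (\<Sum>i\<in>I. cnj (c i) * (c i * complex_of_real (N i)))"
    by (rule sum.cong) (simp_all add: gw flip: sum_distrib_left)
  \<comment> \<open>If \<open>N i = 0\<close> then \<open>c i = 0\<close> by the convention for
    division by zero, so both summands vanish; otherwise \<open>N i\<close> cancels.\<close>
  also have "\<dots> = (\<Sum>i\<in>I. cnj (c i) * ip i)"
    by (rule sum.cong) (auto simp: c_def)
  finally have ww: "(\<Sum>s\<in>S. cnj (w s) * w s) = complex_of_real P"
    by (simp add: ci P_def)
  have pt: "(cmod (a s - w s))\<^sup>2 = (cmod (a s))\<^sup>2 - 2 * Re (cnj (w s) * a s) + Re (cnj (w s) * w s)" for s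
    by (simp add: cmod_power2) (simp add: power2_eq_square algebra_simps)
  \<comment> \<open>The squared distance from \<open>a\<close> to its projection is the squared
    length of \<open>a\<close> minus \<open>P\<close>.\<close>
  have "0 \<le> (\<Sum>s\<in>S. (cmod (a s - w s))\<^sup>2)" by (intro sum_nonneg) auto
  also have "\<dots> = (\<Sum>s\<in>S. (cmod (a s))\<^sup>2) - 2 * Re (\<Sum>s\<in>S. cnj (w s) * a s) + Re (\<Sum>s\<in>S. cnj (w s) * w s)"
    unfolding pt by (simp only: sum.distrib sum_subtractf Re_sum sum_distrib_left)
  also have "\<dots> = (\<Sum>s\<in>S. (cmod (a s))\<^sup>2) - P" unfolding wa ww by simp
  finally show ?thesis unfolding P_def ip_def by simp
qed

text \<open>Each \<open>d i\<close> is a combination of products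
  \<open>\<gamma> k i * \<beta> k i\<close>, which separate the influence of \<open>a k\<close> from
  that of \<open>b k\<close>. Division by \<open>sqrt (d i)\<close> normalises the columns of
  \<open>X * U\<close>; then Cauchy-Schwarz over \<open>i\<close> and two uses of Bessel give the
  bound for each \<open>k\<close>.\<close>

theorem trace_norm_le_sum_rank_one:
  assumes X: "X \<in> carrier_mat m n"
    and entries: "\<And>r c. r < m \<Longrightarrow> c < n \<Longrightarrow>
      X $$ (r, c) = (\<Sum>k<K. complex_of_real (p k) * (a k r * b k c))"
    and p: "\<And>k. k < K \<Longrightarrow> 0 \<le> p k"
  shows "trace_norm X \<le>
    (\<Sum>k<K. p k * (sqrt (\<Sum>r<m. (cmod (a k r))\<^sup>2) * sqrt (\<Sum>c<n. (cmod (b k c))\<^sup>2)))"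
proof -
  obtain U d where U: "U \<in> carrier_mat n n" and UU: "cadj U * U = 1\<^sub>m n"
    and d0: "\<And>i. i < n \<Longrightarrow> 0 \<le> d i" and diag: "cadj (X * U) * (X * U) = rdiag n d"
    and tn: "trace_norm X = (\<Sum>i<n. sqrt (d i))"
    using trace_norm_singular_values[OF X] by blast
  define Y where "Y = X * U"
  have Y: "Y \<in> carrier_mat m n" using X U by (simp add: Y_def)
  define \<gamma> where "\<gamma> k i = (\<Sum>r<m. cnj (Y $$ (r, i)) * a k r)" for k i
  \<comment> \<open>No conjugate occurs here because the rank-one pieces use the plain transpose of
    \<open>b k\<close>. Hence Bessel is applied below to the conjugated columns of
    \<open>U\<close>.\<close>
  define \<beta> where "\<beta> k i = (\<Sum>c<n. U $$ (c, i) * b k c)" for k i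
  have Yri: "Y $$ (r, i) = (\<Sum>k<K. complex_of_real (p k) * (a k r * \<beta> k i))"
    if "r < m" "i < n" for r i
  proof -
    have "Y $$ (r, i) = (\<Sum>c<n. X $$ (r, c) * U $$ (c, i))"
      unfolding Y_def by (rule index_mult_mat_sum[OF X U that])
    also have "\<dots> = (\<Sum>c<n. \<Sum>k<K. complex_of_real (p k) * (a k r * (U $$ (c, i) * b k c)))"
      by (rule sum.cong) (use that in \<open>simp_all add: entries sum_distrib_left mult_ac\<close>)
    also have "\<dots> = (\<Sum>k<K. complex_of_real (p k) * (a k r * \<beta> k i))"
      unfolding \<beta>_def by (subst sum.swap) (simp add: sum_distrib_left)
    finally show ?thesis .
  qed
  have Yorth: "(\<Sum>r<m. cnj (Y $$ (r, i)) * Y $$ (r, j)) = (if i = j then complex_of_real (d i) else 0)"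
    if "i < n" "j < n" for i j
  proof -
    have "(\<Sum>r<m. cnj (Y $$ (r, i)) * Y $$ (r, j)) = (\<Sum>r<m. cadj Y $$ (i, r) * Y $$ (r, j))"
      using Y that by (intro sum.cong) auto
    also have "\<dots> = (cadj Y * Y) $$ (i, j)"
      using Y that by (subst index_mult_mat_sum[of _ n m _ n]) auto
    finally show ?thesis using that by (simp only: Y_def diag index_rdiag)
  qed
  \<comment> \<open>The double conjugate matches the shape of the Bessel hypothesis for the vectors
    \<open>cnj (U $$ (c, i))\<close>.\<close>
  have Uorth: "(\<Sum>c<n. cnj (cnj (U $$ (c, i))) * cnj (U $$ (c, j))) = (if i = j then complex_of_real 1 else 0)"
    if "i < n" "j < n" for i j
  proof -
    have "(\<Sum>c<n. cnj (cnj (U $$ (c, i))) * cnj (U $$ (c, j))) = (\<Sum>c<n. cadj U $$ (j, c) * U $$ (c, i))"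
      using U that by (intro sum.cong) auto
    also have "\<dots> = (cadj U * U) $$ (j, i)"
      using U that by (subst index_mult_mat_sum[of _ n n _ n]) auto
    finally show ?thesis using that by (simp add: UU)
  qed
  have sd: "sqrt (d i) \<le> (\<Sum>k<K. p k * (cmod (\<gamma> k i) / sqrt (d i) * cmod (\<beta> k i)))" if i: "i < n" for i
  proof -
    have "complex_of_real (d i) = (\<Sum>r<m. cnj (Y $$ (r, i)) * Y $$ (r, i))"
      using Yorth[OF i i] by simp
    \<comment> \<open>Only the second factor is expanded; the first stays a column of
      \<open>Y\<close> and pairs with \<open>a k\<close> to form
      \<open>\<gamma> k i\<close>.\<close>
    also have "\<dots> = (\<Sum>r<m. \<Sum>k<K. complex_of_real (p k) * (cnj (Y $$ (r, i)) * a k r * \<beta> k i))"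
      by (rule sum.cong[OF refl], subst (2) Yri) (use i in \<open>simp_all add: sum_distrib_left mult_ac\<close>)
    also have "\<dots> = (\<Sum>k<K. complex_of_real (p k) * (\<gamma> k i * \<beta> k i))"
      unfolding \<gamma>_def by (subst sum.swap) (simp add: sum_distrib_left sum_distrib_right)
    finally have "d i = cmod (\<Sum>k<K. complex_of_real (p k) * (\<gamma> k i * \<beta> k i))"
      using d0[OF i] by (metis norm_of_real abs_of_nonneg)
    also have "\<dots> \<le> (\<Sum>k<K. cmod (complex_of_real (p k) * (\<gamma> k i * \<beta> k i)))" by (rule norm_sum)
    also have "\<dots> = (\<Sum>k<K. p k * (cmod (\<gamma> k i) * cmod (\<beta> k i)))"
      by (rule sum.cong) (simp_all add: norm_mult p)
    finally have le: "d i \<le> (\<Sum>k<K. p k * (cmod (\<gamma> k i) * cmod (\<beta> k i)))" .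
    \<comment> \<open>This also holds for \<open>d i = 0\<close>, so vanishing singular values need
      no separate case.\<close>
    have "sqrt (d i) = d i / sqrt (d i)" using d0[OF i] by (simp add: real_div_sqrt)
    also have "\<dots> \<le> (\<Sum>k<K. p k * (cmod (\<gamma> k i) * cmod (\<beta> k i))) / sqrt (d i)"
      by (rule divide_right_mono[OF le]) (use d0[OF i] in simp)
    finally show ?thesis by (simp add: sum_divide_distrib)
  qed
  have cs: "(\<Sum>i<n. cmod (\<gamma> k i) / sqrt (d i) * cmod (\<beta> k i))
      \<le> sqrt (\<Sum>r<m. (cmod (a k r))\<^sup>2) * sqrt (\<Sum>c<n. (cmod (b k c))\<^sup>2)" for k
  proof -
    have "(\<Sum>i<n. cmod (\<gamma> k i) / sqrt (d i) * cmod (\<beta> k i))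
        \<le> (\<Sum>i<n. \<bar>cmod (\<gamma> k i) / sqrt (d i)\<bar> * \<bar>cmod (\<beta> k i)\<bar>)"
      by (rule sum_mono) (metis abs_ge_self abs_mult)
    also have "\<dots> \<le> L2_set (\<lambda>i. cmod (\<gamma> k i) / sqrt (d i)) {..<n} * L2_set (\<lambda>i. cmod (\<beta> k i)) {..<n}"
      by (rule L2_set_mult_ineq)
    also have "\<dots> \<le> sqrt (\<Sum>r<m. (cmod (a k r))\<^sup>2) * sqrt (\<Sum>c<n. (cmod (b k c))\<^sup>2)"
    proof (rule mult_mono)
      have "(\<Sum>i<n. (cmod (\<gamma> k i) / sqrt (d i))\<^sup>2) = (\<Sum>i<n. (cmod (\<gamma> k i))\<^sup>2 / d i)"
        by (rule sum.cong) (simp_all add: power_divide d0)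
      also have "\<dots> \<le> (\<Sum>r<m. (cmod (a k r))\<^sup>2)"
        unfolding \<gamma>_def by (rule bessel_inequality) (use Yorth in auto)
      finally show "L2_set (\<lambda>i. cmod (\<gamma> k i) / sqrt (d i)) {..<n} \<le> sqrt (\<Sum>r<m. (cmod (a k r))\<^sup>2)"
        by (simp add: L2_set_def)
      have "(\<Sum>i<n. (cmod (\<beta> k i))\<^sup>2) \<le> (\<Sum>c<n. (cmod (b k c))\<^sup>2)"
        using bessel_inequality[where I = "{..<n}" and S = "{..<n}" and g = "\<lambda>i c. cnj (U $$ (c, i))"
            and N = "\<lambda>_. 1" and a = "b k"] Uorth
        by (simp add: \<beta>_def)
      then show "L2_set (\<lambda>i. cmod (\<beta> k i)) {..<n} \<le> sqrt (\<Sum>c<n. (cmod (b k c))\<^sup>2)"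
        by (simp add: L2_set_def)
    qed (auto simp: L2_set_nonneg sum_nonneg)
    finally show ?thesis .
  qed
  have "trace_norm X \<le> (\<Sum>i<n. \<Sum>k<K. p k * (cmod (\<gamma> k i) / sqrt (d i) * cmod (\<beta> k i)))"
    unfolding tn by (rule sum_mono) (use sd in auto)
  also have "\<dots> = (\<Sum>k<K. p k * (\<Sum>i<n. cmod (\<gamma> k i) / sqrt (d i) * cmod (\<beta> k i)))"
    by (subst sum.swap) (simp add: sum_distrib_left)
  also have "\<dots> \<le> (\<Sum>k<K. p k * (sqrt (\<Sum>r<m. (cmod (a k r))\<^sup>2) * sqrt (\<Sum>c<n. (cmod (b k c))\<^sup>2)))"
    by (intro sum_mono mult_left_mono cs) (use p in auto)
  finally show ?thesis .
qed

section \<open>Correlation vectors of separable states\<close>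

lemma sum_div_mod:
  fixes f :: "nat \<Rightarrow> nat \<Rightarrow> 'a::comm_monoid_add"
  shows "(\<Sum>r<a * b. f (r div b) (r mod b)) = (\<Sum>i<a. \<Sum>j<b. f i j)"
proof -
  have less: "i * b + j < a * b" if "i < a" "j < b" for i j
  proof -
    have "i * b + j < Suc i * b" using that by simp
    also have "\<dots> \<le> a * b" using that by (intro mult_le_mono1) simp
    finally show ?thesis .
  qed
  have "(\<Sum>i<a. \<Sum>j<b. f i j) = (\<Sum>(i, j)\<in>{..<a} \<times> {..<b}. f i j)"
    by (rule sum.cartesian_product)
  also have "\<dots> = (\<Sum>r<a * b. f (r div b) (r mod b))"
  proof (rule sum.reindex_bij_witness[of _ "\<lambda>r. (r div b, r mod b)" "\<lambda>(i, j). i * b + j"])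
    fix r assume r: "r \<in> {..<a * b}"
    then have "0 < b" by (cases b) auto
    with r show "(r div b, r mod b) \<in> {..<a} \<times> {..<b}"
      by (auto simp: less_mult_imp_div_less)
  qed (auto simp: less)
  finally show ?thesis by simp
qed

lemma sum_lessThan_add:
  fixes f :: "nat \<Rightarrow> 'a::comm_monoid_add"
  shows "(\<Sum>r<m + n. f r) = (\<Sum>i<m. f i) + (\<Sum>i<n. f (m + i))"
  by (induction n) (simp_all add: add.assoc)

lemma kron_carrier [intro]:
  assumes "A \<in> carrier_mat m n" "B \<in> carrier_mat k l"
  shows "kron A B \<in> carrier_mat (m * k) (n * l)"
  using assms by (auto simp: kron_def)

lemma index_kron:
  assumes "A \<in> carrier_mat m n" "B \<in> carrier_mat k l" "i < m * k" "j < n * l"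
  shows "kron A B $$ (i, j) = A $$ (i div k, j div l) * B $$ (i mod k, j mod l)"
  using assms by (auto simp: kron_def)

text \<open>Entries of Kronecker products factor along the two components of a composite index, so
  the sum over composite rows and columns becomes a fourfold sum that splits into two
  traces.\<close>

lemma mtrace_kron_mult:
  assumes A: "A \<in> carrier_mat m m" and B: "B \<in> carrier_mat n n"
    and G: "G \<in> carrier_mat m m" and H: "H \<in> carrier_mat n n"
  shows "mtrace (kron A B * kron G H) = mtrace (A * G) * mtrace (B * H)"
proof -
  \<comment> \<open>The summand as a function of four simple indices, so that
    \<open>sum_div_mod\<close> can be applied first to the columns and then to the rows.\<close>
  define F where "F i j i' j' = (A $$ (i, i') * G $$ (i', i)) * (B $$ (j, j') * H $$ (j', j))" for i j i' j'
  have "mtrace (kron A B * kron G H) =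
      (\<Sum>r<m * n. \<Sum>c<m * n. kron A B $$ (r, c) * kron G H $$ (c, r))"
    using A B G H by (intro mtrace_mult) auto
  also have "\<dots> = (\<Sum>r<m * n. \<Sum>c<m * n. F (r div n) (r mod n) (c div n) (c mod n))"
    by (intro sum.cong refl) (simp add: index_kron[OF A B] index_kron[OF G H] F_def mult_ac)
  also have "\<dots> = (\<Sum>r<m * n. \<Sum>i'<m. \<Sum>j'<n. F (r div n) (r mod n) i' j')"
    by (simp only: sum_div_mod)
  also have "\<dots> = (\<Sum>i<m. \<Sum>j<n. \<Sum>i'<m. \<Sum>j'<n. F i j i' j')"
    by (rule sum_div_mod)
  also have "\<dots> = mtrace (A * G) * mtrace (B * H)"
    unfolding mtrace_mult[OF A G] mtrace_mult[OF B H] F_def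
    by (simp only: sum_product)
  finally show ?thesis .
qed

section \<open>Pure states and the length of their correlation vectors\<close>

lemma pure_state_carrier: "pure_state d \<rho> \<Longrightarrow> \<rho> \<in> carrier_mat d d"
  by (auto simp: pure_state_def)

lemma mtrace_pure_state:
  assumes "pure_state d \<rho>"
  shows "mtrace \<rho> = 1"
proof -
  from assms obtain \<psi> where \<psi>: "(\<Sum>i<d. (cmod (\<psi> $ i))\<^sup>2) = 1"
    and \<rho>: "\<rho> = mat d d (\<lambda>(i, j). \<psi> $ i * cnj (\<psi> $ j))"
    by (auto simp: pure_state_def)
  have "mtrace \<rho> = complex_of_real (\<Sum>i<d. (cmod (\<psi> $ i))\<^sup>2)"
    by (simp add: mtrace_def \<rho> complex_norm_square del: of_real_power)
  then show ?thesis using \<psi> by simp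
qed

text \<open>\<open>op_basis\<close> states orthogonality only for positive indices. Tracelessness
  makes the others orthogonal to \<open>G 0\<close>, the identity, whose squared Hilbert-Schmidt
  norm is \<open>d\<close> rather than \<open>\<kappa>\<close>. The sum over index pairs is the form
  that \<open>bessel_inequality\<close> expects.\<close>

lemma op_basis_orthogonal:
  assumes G: "op_basis d \<kappa> G" and ij: "i < d\<^sup>2" "j < d\<^sup>2"
  shows "(\<Sum>s\<in>{..<d} \<times> {..<d}. cnj (G i $$ s) * G j $$ s)
    = (if i = j then complex_of_real (if i = 0 then real d else \<kappa>) else 0)"
proof -
  have carr: "G i \<in> carrier_mat d d" "G j \<in> carrier_mat d d" and G0: "G 0 = 1\<^sub>m d"
    using G ij by (auto simp: op_basis_def)
  have tr0: "mtrace (G k) = 0" if "0 < k" "k < d\<^sup>2" for k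
    using G that by (auto simp: op_basis_def)
  have cadj_tr: "mtrace (cadj M) = cnj (mtrace M)" if "M \<in> carrier_mat d d" for M
    using that by (auto simp: mtrace_def)
  have "(\<Sum>s\<in>{..<d} \<times> {..<d}. cnj (G i $$ s) * G j $$ s)
      = (\<Sum>r<d. \<Sum>c<d. cnj (G i $$ (r, c)) * G j $$ (r, c))"
    by (simp add: sum.cartesian_product case_prod_unfold)
  also have "\<dots> = (\<Sum>c<d. \<Sum>r<d. cadj (G i) $$ (c, r) * G j $$ (r, c))"
    by (subst sum.swap) (use carr in \<open>auto intro!: sum.cong\<close>)
  also have "\<dots> = mtrace (cadj (G i) * G j)"
    using carr by (intro mtrace_mult[symmetric]) (auto intro: cadj_carrier)
  also have "\<dots> = (if i = j then complex_of_real (if i = 0 then real d else \<kappa>) else 0)"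
  proof (cases "i = 0 \<or> j = 0")
    case True
    then show ?thesis
    proof
      assume "i = 0"
      then show ?thesis using carr tr0[of j] ij by (cases "j = 0") (auto simp: G0 mtrace_def)
    next
      assume j: "j = 0"
      have "cadj (G i) * G j = cadj (G i)" unfolding j G0 using cadj_carrier[OF carr(1)] by (rule right_mult_one_mat)
      then show ?thesis using carr tr0[of i] ij j
        by (cases "i = 0") (auto simp: cadj_tr, auto simp: G0 mtrace_def)
    qed
  next
    case False
    then show ?thesis using G ij by (auto simp: op_basis_def)
  qed
  finally show ?thesis .
qed

text \<open>Bessel over the whole basis bounds the components by the purity 1. The identity
  component takes up \<open>1 / d\<close>, leaving \<open>1 - 1 / d\<close> for the others; the
  scaling \<open>d / \<kappa>\<close> turns this into the stated bound.\<close>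

lemma pure_state_correlation_norm:
  assumes \<rho>: "pure_state d \<rho>" and G: "op_basis d \<kappa> G" and d: "0 < d" and \<kappa>: "0 < \<kappa>"
  shows "(\<Sum>k<d\<^sup>2 - 1. (cmod (complex_of_real (real d / \<kappa>) * mtrace (\<rho> * G (k + 1))))\<^sup>2)
    \<le> (real d ^ 2 - real d) / \<kappa>"
proof -
  from \<rho> obtain \<psi> where \<psi>: "(\<Sum>i<d. (cmod (\<psi> $ i))\<^sup>2) = 1"
    and \<rho>_eq: "\<rho> = mat d d (\<lambda>(i, j). \<psi> $ i * cnj (\<psi> $ j))"
    by (auto simp: pure_state_def)
  note \<rho>c = pure_state_carrier[OF \<rho>]
  have herm: "cnj (\<rho> $$ (r, c)) = \<rho> $$ (c, r)" if "r < d" "c < d" for r c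
    using that by (simp add: \<rho>_eq)
  let ?S = "{..<d} \<times> {..<d}"
  \<comment> \<open>The elements \<open>G i\<close> may be non-Hermitian, so the inner product is
    only the conjugate of the trace; the moduli agree.\<close>
  have ip: "cmod (\<Sum>s\<in>?S. cnj (G i $$ s) * \<rho> $$ s) = cmod (mtrace (\<rho> * G i))" if i: "i < d\<^sup>2" for i
  proof -
    have Gc: "G i \<in> carrier_mat d d" using G i by (auto simp: op_basis_def)
    have "(\<Sum>s\<in>?S. cnj (G i $$ s) * \<rho> $$ s) = (\<Sum>c<d. \<Sum>r<d. cnj (G i $$ (c, r)) * \<rho> $$ (c, r))"
      by (simp add: sum.cartesian_product case_prod_unfold)
    also have "\<dots> = (\<Sum>r<d. \<Sum>c<d. cnj (\<rho> $$ (r, c) * G i $$ (c, r)))"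
      by (subst sum.swap) (auto simp: herm intro!: sum.cong)
    also have "\<dots> = cnj (mtrace (\<rho> * G i))"
      by (simp only: mtrace_mult[OF \<rho>c Gc] cnj_sum)
    finally show ?thesis by simp
  qed
  have "(\<Sum>s\<in>?S. (cmod (\<rho> $$ s))\<^sup>2) = (\<Sum>i<d. \<Sum>j<d. (cmod (\<rho> $$ (i, j)))\<^sup>2)"
    by (simp add: sum.cartesian_product case_prod_unfold)
  also have "\<dots> = (\<Sum>i<d. \<Sum>j<d. (cmod (\<psi> $ i))\<^sup>2 * (cmod (\<psi> $ j))\<^sup>2)"
    by (intro sum.cong refl) (simp add: \<rho>_eq norm_mult power_mult_distrib)
  also have "\<dots> = 1" by (simp add: \<psi> flip: sum_product)
  finally have purity: "(\<Sum>s\<in>?S. (cmod (\<rho> $$ s))\<^sup>2) = 1" .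
  have "(\<Sum>i<d\<^sup>2. (cmod (\<Sum>s\<in>?S. cnj (G i $$ s) * \<rho> $$ s))\<^sup>2 / (if i = 0 then real d else \<kappa>)) \<le> 1"
    unfolding purity[symmetric]
    by (rule bessel_inequality) (use op_basis_orthogonal[OF G] in auto)
  then have "(\<Sum>i<d\<^sup>2. (cmod (mtrace (\<rho> * G i)))\<^sup>2 / (if i = 0 then real d else \<kappa>)) \<le> 1"
    by (simp add: ip)
  \<comment> \<open>Splits off the identity and shifts the rest, so that coordinate \<open>k\<close>
    belongs to basis element \<open>k + 1\<close>.\<close>
  moreover have "d\<^sup>2 = Suc (d\<^sup>2 - 1)" using d by simp
  ultimately have "(\<Sum>i<Suc (d\<^sup>2 - 1). (cmod (mtrace (\<rho> * G i)))\<^sup>2 / (if i = 0 then real d else \<kappa>)) \<le> 1"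
    by simp
  then have *: "(cmod (mtrace (\<rho> * G 0)))\<^sup>2 / real d
      + (\<Sum>k<d\<^sup>2 - 1. (cmod (mtrace (\<rho> * G (k + 1))))\<^sup>2) / \<kappa> \<le> 1"
    unfolding sum.lessThan_Suc_shift by (simp add: sum_divide_distrib)
  have "\<rho> * G 0 = \<rho>" using G \<rho>c by (simp add: op_basis_def)
  with * have "1 / real d + (\<Sum>k<d\<^sup>2 - 1. (cmod (mtrace (\<rho> * G (k + 1))))\<^sup>2) / \<kappa> \<le> 1"
    using mtrace_pure_state[OF \<rho>] by simp
  then have le: "(\<Sum>k<d\<^sup>2 - 1. (cmod (mtrace (\<rho> * G (k + 1))))\<^sup>2) / \<kappa> \<le> 1 - 1 / real d" by simp
  have "(\<Sum>k<d\<^sup>2 - 1. (cmod (complex_of_real (real d / \<kappa>) * mtrace (\<rho> * G (k + 1))))\<^sup>2)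
      = (real d)\<^sup>2 / \<kappa> * ((\<Sum>k<d\<^sup>2 - 1. (cmod (mtrace (\<rho> * G (k + 1))))\<^sup>2) / \<kappa>)"
    using \<kappa> by (simp add: norm_mult norm_divide power_mult_distrib power_divide sum_distrib_left
        sum_divide_distrib power2_eq_square mult_ac)
  also have "\<dots> \<le> (real d)\<^sup>2 / \<kappa> * (1 - 1 / real d)"
    by (rule mult_left_mono[OF le]) (use \<kappa> in simp)
  also have "\<dots> = (real d ^ 2 - real d) / \<kappa>"
    using d \<kappa> by (simp add: field_simps power2_eq_square)
  finally show ?thesis .
qed

text \<open>The column vector \<open>(u; \<alpha> \<otimes> t)\<close> with \<open>t\<close> of length \<open>m\<close>.\<close>
definition stacked_vec :: "real vec \<Rightarrow> real vec \<Rightarrow> nat \<Rightarrow> (nat \<Rightarrow> complex) \<Rightarrow> nat \<Rightarrow> complex" where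
  "stacked_vec u \<alpha> m t r = (if r < dim_vec u then complex_of_real (u $ r)
     else complex_of_real (\<alpha> $ ((r - dim_vec u) div m)) * t ((r - dim_vec u) mod m))"

text \<open>The Euclidean norm is multiplicative on the Kronecker product in the lower part.\<close>

lemma stacked_vec_norm:
  "(\<Sum>r<dim_vec u + dim_vec \<alpha> * m. (cmod (stacked_vec u \<alpha> m t r))\<^sup>2)
    = vnorm2 u + vnorm2 \<alpha> * (\<Sum>i<m. (cmod (t i))\<^sup>2)"
proof -
  have "(\<Sum>r<dim_vec \<alpha> * m. (cmod (stacked_vec u \<alpha> m t (dim_vec u + r)))\<^sup>2)
      = (\<Sum>r<dim_vec \<alpha> * m. (\<alpha> $ (r div m))\<^sup>2 * (cmod (t (r mod m)))\<^sup>2)"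
    by (simp add: stacked_vec_def norm_mult power_mult_distrib)
  also have "\<dots> = vnorm2 \<alpha> * (\<Sum>i<m. (cmod (t i))\<^sup>2)"
    unfolding sum_div_mod[of "\<lambda>i j. (\<alpha> $ i)\<^sup>2 * (cmod (t j))\<^sup>2"] vnorm2_def sum_product ..
  finally show ?thesis
    unfolding sum_lessThan_add by (simp add: vnorm2_def stacked_vec_def)
qed

text \<open>The correlation data are linear in the state, and on a product state \<open>TAB\<close>
  factors into the two local correlation vectors. Hence the block matrix is the convex combination
  of the outer products of stacked vectors.\<close>

lemma Mmat_separable_decomposition:
  fixes u v \<alpha> \<beta> :: "real vec"
  assumes GA: "op_basis dA \<kappa>A GA" and GB: "op_basis dB \<kappa>B GB"
    and pure: "\<And>k. k < K \<Longrightarrow> pure_state dA (\<rho>A k)" "\<And>k. k < K \<Longrightarrow> pure_state dB (\<rho>B k)"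
    and p: "(\<Sum>k<K. p k) = 1"
    and \<rho>: "\<rho> = mat (dA * dB) (dA * dB)
      (\<lambda>(r, c). \<Sum>k<K. complex_of_real (p k) * kron (\<rho>A k) (\<rho>B k) $$ (r, c))"
  defines "tA \<equiv> \<lambda>k i. complex_of_real (real dA / \<kappa>A) * mtrace (\<rho>A k * GA (i + 1))"
    and "tB \<equiv> \<lambda>k j. complex_of_real (real dB / \<kappa>B) * mtrace (\<rho>B k * GB (j + 1))"
    and "M \<equiv> Mmat dA dB \<kappa>A \<kappa>B GA GB u v \<alpha> \<beta> \<rho>"
    and "m \<equiv> dim_vec u + dim_vec \<alpha> * (dA\<^sup>2 - 1)" and "n \<equiv> dim_vec v + dim_vec \<beta> * (dB\<^sup>2 - 1)"
  shows "M \<in> carrier_mat m n"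
    and "\<And>r c. r < m \<Longrightarrow> c < n \<Longrightarrow> M $$ (r, c) = (\<Sum>k<K. complex_of_real (p k) *
      (stacked_vec u \<alpha> (dA\<^sup>2 - 1) (tA k) r * stacked_vec v \<beta> (dB\<^sup>2 - 1) (tB k) c))"
proof -
  define mA where "mA = dA\<^sup>2 - 1"
  define mB where "mB = dB\<^sup>2 - 1"
  have tr: "mtrace (\<rho> * kron G H)
      = (\<Sum>k<K. complex_of_real (p k) * (mtrace (\<rho>A k * G) * mtrace (\<rho>B k * H)))"
    if G: "G \<in> carrier_mat dA dA" and H: "H \<in> carrier_mat dB dB" for G H
  proof -
    let ?N = "dA * dB"
    have "mtrace (\<rho> * kron G H) = (\<Sum>r<?N. \<Sum>c<?N. \<rho> $$ (r, c) * kron G H $$ (c, r))"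
      using G H by (intro mtrace_mult) (auto simp: \<rho>)
    also have "\<dots> = (\<Sum>r<?N. \<Sum>c<?N. \<Sum>k<K. complex_of_real (p k) *
        (kron (\<rho>A k) (\<rho>B k) $$ (r, c) * kron G H $$ (c, r)))"
      by (intro sum.cong refl) (simp add: \<rho> sum_distrib_left sum_distrib_right mult_ac)
    also have "\<dots> = (\<Sum>r<?N. \<Sum>k<K. \<Sum>c<?N. complex_of_real (p k) *
        (kron (\<rho>A k) (\<rho>B k) $$ (r, c) * kron G H $$ (c, r)))"
      by (intro sum.cong refl) (rule sum.swap)
    also have "\<dots> = (\<Sum>k<K. complex_of_real (p k) *
        (\<Sum>r<?N. \<Sum>c<?N. kron (\<rho>A k) (\<rho>B k) $$ (r, c) * kron G H $$ (c, r)))"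
      by (subst sum.swap) (simp only: sum_distrib_left)
    also have "\<dots> = (\<Sum>k<K. complex_of_real (p k) * (mtrace (\<rho>A k * G) * mtrace (\<rho>B k * H)))"
    proof (rule sum.cong[OF refl])
      fix k assume "k \<in> {..<K}"
      then have A: "\<rho>A k \<in> carrier_mat dA dA" and B: "\<rho>B k \<in> carrier_mat dB dB"
        using pure pure_state_carrier by auto
      have "(\<Sum>r<?N. \<Sum>c<?N. kron (\<rho>A k) (\<rho>B k) $$ (r, c) * kron G H $$ (c, r))
          = mtrace (kron (\<rho>A k) (\<rho>B k) * kron G H)"
        using A B G H by (intro mtrace_mult[symmetric]) auto
      then show "complex_of_real (p k) * (\<Sum>r<?N. \<Sum>c<?N. kron (\<rho>A k) (\<rho>B k) $$ (r, c) * kron G H $$ (c, r))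
          = complex_of_real (p k) * (mtrace (\<rho>A k * G) * mtrace (\<rho>B k * H))"
        by (simp only: mtrace_kron_mult[OF A B G H])
    qed
    finally show ?thesis .
  qed
  \<comment> \<open>The unit trace of the other factor makes each local correlation vector depend on
    its own factor alone.\<close>
  have trA1: "mtrace (\<rho>A k * 1\<^sub>m dA) = 1" and trB1: "mtrace (\<rho>B k * 1\<^sub>m dB) = 1" if "k < K" for k
    using pure[OF that, THEN mtrace_pure_state]
    by (simp_all only: pure[OF that, THEN pure_state_carrier, THEN right_mult_one_mat])
  have GAc: "GA (i + 1) \<in> carrier_mat dA dA" if "i < mA" for i
    using GA that by (auto simp: op_basis_def mA_def)
  have GBc: "GB (j + 1) \<in> carrier_mat dB dB" if "j < mB" for j
    using GB that by (auto simp: op_basis_def mB_def)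
  have TA: "TA dA dB \<kappa>A GA \<rho> $ i = (\<Sum>k<K. complex_of_real (p k) * tA k i)" if i: "i < mA" for i
    using i unfolding TA_def tA_def mA_def[symmetric]
    by (simp add: tr[OF GAc[OF i, simplified]] trB1 sum_distrib_left sum_divide_distrib mult_ac)
  have TB: "TB dA dB \<kappa>B GB \<rho> $ j = (\<Sum>k<K. complex_of_real (p k) * tB k j)" if j: "j < mB" for j
    using j unfolding TB_def tB_def mB_def[symmetric]
    by (simp add: tr[OF _ GBc[OF j, simplified]] trA1 sum_distrib_left sum_divide_distrib mult_ac)
  have TAB: "TAB dA dB \<kappa>A \<kappa>B GA GB \<rho> $$ (i, j) = (\<Sum>k<K. complex_of_real (p k) * (tA k i * tB k j))"
    if i: "i < mA" and j: "j < mB" for i j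
    using i j unfolding TAB_def tA_def tB_def mA_def[symmetric] mB_def[symmetric]
    by (simp add: tr[OF GAc[OF i, simplified] GBc[OF j, simplified]] sum_distrib_left sum_divide_distrib mult_ac)
  let ?TA = "colm (TA dA dB \<kappa>A GA \<rho>)" and ?TB = "colm (TB dA dB \<kappa>B GB \<rho>)"
    and ?TAB = "TAB dA dB \<kappa>A \<kappa>B GA GB \<rho>"
  have uc: "colm (cv w) \<in> carrier_mat (dim_vec w) 1" for w by (simp add: colm_def cv_def)
  have TAc: "?TA \<in> carrier_mat mA 1" by (simp add: colm_def TA_def mA_def)
  have TBc: "?TB \<in> carrier_mat mB 1" by (simp add: colm_def TB_def mB_def)
  have TABc: "?TAB \<in> carrier_mat mA mB" by (simp add: TAB_def mA_def mB_def)
  have rank1: "(A * transpose_mat B) $$ (i, j) = A $$ (i, 0) * B $$ (j, 0)"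
    if "A \<in> carrier_mat k 1" "B \<in> carrier_mat l 1" "i < k" "j < l" for A B :: "complex mat" and i j k l
    using that by (subst index_mult_mat_sum[of _ k 1 _ l]) auto
  have colm_i: "colm w $$ (i, 0) = w $ i" if "i < dim_vec w" for w i
    using that by (simp add: colm_def)
  have cvi: "colm (cv w) $$ (i, 0) = complex_of_real (w $ i)" if "i < dim_vec w" for w i
    using that by (simp add: colm_def cv_def)
  \<comment> \<open>The premise excludes \<open>b = 0\<close>, so the bounds also cover correlation
    vectors of length zero, which occur in dimension 1.\<close>
  have div_less: "i div b < a" "i mod b < b" if "i < a * b" for i a b :: nat
    using that by (cases "b = 0"; simp add: less_mult_imp_div_less)+
  have kA: "kron (colm (cv \<alpha>)) ?TA \<in> carrier_mat (dim_vec \<alpha> * mA) 1"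
    using kron_carrier[OF uc TAc] by simp
  have kB: "kron (colm (cv \<beta>)) ?TB \<in> carrier_mat (dim_vec \<beta> * mB) 1"
    using kron_carrier[OF uc TBc] by simp
  have ab: "colm (cv \<alpha>) * transpose_mat (colm (cv \<beta>)) \<in> carrier_mat (dim_vec \<alpha>) (dim_vec \<beta>)"
    using uc[of \<alpha>] uc[of \<beta>] by auto
  have uv: "colm (cv u) * transpose_mat (colm (cv v)) \<in> carrier_mat (dim_vec u) (dim_vec v)"
    using uc[of u] uc[of v] by auto
  have kAB: "kron (colm (cv \<alpha>) * transpose_mat (colm (cv \<beta>))) ?TAB
      \<in> carrier_mat (dim_vec \<alpha> * mA) (dim_vec \<beta> * mB)"
    using kron_carrier[OF ab TABc] .
  have kAi: "kron (colm (cv \<alpha>)) ?TA $$ (i, 0)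
      = (\<Sum>k<K. complex_of_real (p k) * (complex_of_real (\<alpha> $ (i div mA)) * tA k (i mod mA)))"
    if i: "i < dim_vec \<alpha> * mA" for i
  proof -
    have "kron (colm (cv \<alpha>)) ?TA $$ (i, 0) = colm (cv \<alpha>) $$ (i div mA, 0) * ?TA $$ (i mod mA, 0)"
      using index_kron[OF uc TAc, of i \<alpha> 0] i by simp
    also have "\<dots> = complex_of_real (\<alpha> $ (i div mA)) * TA dA dB \<kappa>A GA \<rho> $ (i mod mA)"
      using div_less[OF i] by (simp add: cvi colm_i TA_def mA_def)
    finally show ?thesis using div_less[OF i] by (simp add: TA sum_distrib_left mult_ac)
  qed
  have kBi: "kron (colm (cv \<beta>)) ?TB $$ (j, 0)
      = (\<Sum>k<K. complex_of_real (p k) * (complex_of_real (\<beta> $ (j div mB)) * tB k (j mod mB)))"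
    if j: "j < dim_vec \<beta> * mB" for j
  proof -
    have "kron (colm (cv \<beta>)) ?TB $$ (j, 0) = colm (cv \<beta>) $$ (j div mB, 0) * ?TB $$ (j mod mB, 0)"
      using index_kron[OF uc TBc, of j \<beta> 0] j by simp
    also have "\<dots> = complex_of_real (\<beta> $ (j div mB)) * TB dA dB \<kappa>B GB \<rho> $ (j mod mB)"
      using div_less[OF j] by (simp add: cvi colm_i TB_def mB_def)
    finally show ?thesis using div_less[OF j] by (simp add: TB sum_distrib_left mult_ac)
  qed
  have kABi: "kron (colm (cv \<alpha>) * transpose_mat (colm (cv \<beta>))) ?TAB $$ (i, j)
      = (\<Sum>k<K. complex_of_real (p k) * ((complex_of_real (\<alpha> $ (i div mA)) * tA k (i mod mA))
          * (complex_of_real (\<beta> $ (j div mB)) * tB k (j mod mB))))"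
    if i: "i < dim_vec \<alpha> * mA" and j: "j < dim_vec \<beta> * mB" for i j
    unfolding index_kron[OF ab TABc i j]
    using div_less[OF i] div_less[OF j]
    by (simp add: rank1[OF uc uc] cvi TAB sum_distrib_left mult_ac del: index_mult_mat(1))
  show M: "M \<in> carrier_mat m n"
    unfolding M_def Mmat_def m_def n_def mA_def[symmetric] mB_def[symmetric]
    using uv kAB by (rule four_block_carrier_mat)
  \<comment> \<open>The upper left block is the same for every \<open>k\<close>; it is its own
    convex combination because the weights sum to 1.\<close>
  have p1: "(\<Sum>k<K. complex_of_real (p k)) = 1"
    using p by (metis of_real_sum of_real_1)
  fix r c assume r: "r < m" and c: "c < n"
  have dims: "dim_row (colm (cv u) * transpose_mat (colm (cv v))) = dim_vec u"
    "dim_col (colm (cv u) * transpose_mat (colm (cv v))) = dim_vec v"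
    "dim_row (kron (colm (cv \<alpha>) * transpose_mat (colm (cv \<beta>))) ?TAB) = dim_vec \<alpha> * mA"
    "dim_col (kron (colm (cv \<alpha>) * transpose_mat (colm (cv \<beta>))) ?TAB) = dim_vec \<beta> * mB"
    using uv kAB by (simp_all only: carrier_matD)
  let ?r = "r - dim_vec u" and ?c = "c - dim_vec v"
  have Mrc: "M $$ (r, c) = (if r < dim_vec u then
      if c < dim_vec v then (colm (cv u) * transpose_mat (colm (cv v))) $$ (r, c)
      else (colm (cv u) * transpose_mat (kron (colm (cv \<beta>)) ?TB)) $$ (r, ?c)
      else if c < dim_vec v then (kron (colm (cv \<alpha>)) ?TA * transpose_mat (colm (cv v))) $$ (?r, c)
      else kron (colm (cv \<alpha>) * transpose_mat (colm (cv \<beta>))) ?TAB $$ (?r, ?c))"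
    unfolding M_def Mmat_def using r c
    by (subst index_mat_four_block(1)) (simp_all only: dims m_def n_def mA_def mB_def)
  have rr: "?r < dim_vec \<alpha> * mA" if "\<not> r < dim_vec u" using r that by (simp add: m_def mA_def)
  have cc: "?c < dim_vec \<beta> * mB" if "\<not> c < dim_vec v" using c that by (simp add: n_def mB_def)
  show "M $$ (r, c) = (\<Sum>k<K. complex_of_real (p k) *
      (stacked_vec u \<alpha> (dA\<^sup>2 - 1) (tA k) r * stacked_vec v \<beta> (dB\<^sup>2 - 1) (tB k) c))"
    unfolding mA_def[symmetric] mB_def[symmetric]
  proof (cases "r < dim_vec u"; cases "c < dim_vec v")
    assume rc: "r < dim_vec u" "c < dim_vec v"
    then have "M $$ (r, c) = complex_of_real (u $ r) * complex_of_real (v $ c)"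
      unfolding Mrc by (simp add: rank1[OF uc uc] cvi del: index_mult_mat(1))
    then show "M $$ (r, c) = (\<Sum>k<K. complex_of_real (p k) *
        (stacked_vec u \<alpha> mA (tA k) r * stacked_vec v \<beta> mB (tB k) c))"
      using rc by (simp add: stacked_vec_def p1 flip: sum_distrib_right)
  next
    assume rc: "r < dim_vec u" "\<not> c < dim_vec v"
    then show "M $$ (r, c) = (\<Sum>k<K. complex_of_real (p k) *
        (stacked_vec u \<alpha> mA (tA k) r * stacked_vec v \<beta> mB (tB k) c))"
      unfolding Mrc using cc
      by (simp add: rank1[OF uc kB] cvi kBi stacked_vec_def sum_distrib_left mult_ac del: index_mult_mat(1))
  next
    assume rc: "\<not> r < dim_vec u" "c < dim_vec v"
    then show "M $$ (r, c) = (\<Sum>k<K. complex_of_real (p k) *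
        (stacked_vec u \<alpha> mA (tA k) r * stacked_vec v \<beta> mB (tB k) c))"
      unfolding Mrc using rr
      by (simp add: rank1[OF kA uc] cvi kAi stacked_vec_def sum_distrib_left sum_distrib_right mult_ac del: index_mult_mat(1))
  next
    assume rc: "\<not> r < dim_vec u" "\<not> c < dim_vec v"
    then show "M $$ (r, c) = (\<Sum>k<K. complex_of_real (p k) *
        (stacked_vec u \<alpha> mA (tA k) r * stacked_vec v \<beta> mB (tB k) c))"
      unfolding Mrc using kABi[OF rr cc] by (simp add: stacked_vec_def)
  qed
qed

section \<open>Trace norm bound for separable states\<close>

theorem theorem1:
  fixes dA dB p1 p2 q1 q2 :: nat
    and \<kappa>A \<kappa>B :: real
    and GA GB :: "nat \<Rightarrow> complex mat"
    and \<rho> :: "complex mat"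
    and u v \<alpha> \<beta> :: "real vec"
  assumes "0 < dA" and "0 < dB"
    and "1 \<le> \<kappa>A" and "1 \<le> \<kappa>B"
    and "op_basis dA \<kappa>A GA" and "op_basis dB \<kappa>B GB"
    and "0 < p1" and "0 < p2" and "0 < q1" and "0 < q2"
    and "dim_vec u = p1" and "dim_vec v = p2" and "dim_vec \<alpha> = q1" and "dim_vec \<beta> = q2"
    and "is_state (dA * dB) \<rho>"
    and "separable dA dB \<rho>"
  shows "trace_norm (Mmat dA dB \<kappa>A \<kappa>B GA GB u v \<alpha> \<beta> \<rho>)
         \<le> sqrt ((vnorm2 u + vnorm2 \<alpha> * (real dA ^ 2 - real dA) / \<kappa>A) *
                 (vnorm2 v + vnorm2 \<beta> * (real dB ^ 2 - real dB) / \<kappa>B))"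
proof -
  from \<open>separable dA dB \<rho>\<close> obtain K :: nat and p :: "nat \<Rightarrow> real" and \<rho>A \<rho>B where
    p0: "\<And>k. k < K \<Longrightarrow> 0 \<le> p k"
    and pure: "\<And>k. k < K \<Longrightarrow> pure_state dA (\<rho>A k)" "\<And>k. k < K \<Longrightarrow> pure_state dB (\<rho>B k)"
    and p1: "(\<Sum>k<K. p k) = 1"
    and \<rho>: "\<rho> = mat (dA * dB) (dA * dB)
      (\<lambda>(r, c). \<Sum>k<K. complex_of_real (p k) * kron (\<rho>A k) (\<rho>B k) $$ (r, c))"
    unfolding separable_def by blast
  note M = Mmat_separable_decomposition[OF \<open>op_basis dA \<kappa>A GA\<close> \<open>op_basis dB \<kappa>B GB\<close>
      pure p1 \<rho>, where u = u and v = v and \<alpha> = \<alpha> and \<beta> = \<beta>]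
  \<comment> \<open>\<open>NA\<close> and \<open>NB\<close> bound the squared lengths of the stacked
    vectors uniformly in \<open>k\<close>, so the convex weights can be summed away at the
    end.\<close>
  define NA where "NA = vnorm2 u + vnorm2 \<alpha> * (real dA ^ 2 - real dA) / \<kappa>A"
  define NB where "NB = vnorm2 v + vnorm2 \<beta> * (real dB ^ 2 - real dB) / \<kappa>B"
  have stacked_bound: "vnorm2 w + vnorm2 \<gamma> * (\<Sum>i<d\<^sup>2 - 1.
        (cmod (complex_of_real (real d / \<kappa>) * mtrace (\<sigma> * G (i + 1))))\<^sup>2)
      \<le> vnorm2 w + vnorm2 \<gamma> * (real d ^ 2 - real d) / \<kappa>"
    if "pure_state d \<sigma>" "op_basis d \<kappa> G" "0 < d" "1 \<le> \<kappa>" for d \<sigma> \<kappa> G w \<gamma>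
  proof -
    have "0 \<le> vnorm2 \<gamma>" by (simp add: vnorm2_def sum_nonneg)
    then show ?thesis
      using mult_left_mono[OF pure_state_correlation_norm[of d \<sigma> \<kappa> G]] that by simp
  qed
  have "trace_norm (Mmat dA dB \<kappa>A \<kappa>B GA GB u v \<alpha> \<beta> \<rho>) \<le> (\<Sum>k<K. p k * (sqrt NA * sqrt NB))"
  proof (rule order_trans[OF trace_norm_le_sum_rank_one[OF M p0]])
    show "(\<Sum>k<K. p k * (sqrt (\<Sum>r<dim_vec u + dim_vec \<alpha> * (dA\<^sup>2 - 1). (cmod (stacked_vec u \<alpha> (dA\<^sup>2 - 1)
          (\<lambda>i. complex_of_real (real dA / \<kappa>A) * mtrace (\<rho>A k * GA (i + 1))) r))\<^sup>2)
        * sqrt (\<Sum>c<dim_vec v + dim_vec \<beta> * (dB\<^sup>2 - 1). (cmod (stacked_vec v \<beta> (dB\<^sup>2 - 1)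
          (\<lambda>j. complex_of_real (real dB / \<kappa>B) * mtrace (\<rho>B k * GB (j + 1))) c))\<^sup>2)))
        \<le> (\<Sum>k<K. p k * (sqrt NA * sqrt NB))"
      \<comment> \<open>The monotonicity of products needs nonnegative bounds, which follow from
        \<open>d \<le> d ^ 2\<close> for positive dimensions.\<close>
      unfolding stacked_vec_norm NA_def NB_def
      by (intro sum_mono mult_left_mono mult_mono real_sqrt_le_mono stacked_bound)
        (use assms pure p0 in \<open>auto simp: vnorm2_def self_le_power
          intro!: sum_nonneg add_nonneg_nonneg mult_nonneg_nonneg divide_nonneg_nonneg\<close>)
  qed
  also have "\<dots> = sqrt NA * sqrt NB" by (simp add: p1 flip: sum_distrib_right)
  finally show ?thesis by (simp add: NA_def NB_def real_sqrt_mult)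
qed

end
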